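(* Let $\varphi\colon S\to T$ be a bijection between bounded metric spaces $(S,d)$ and $(T,\varrho)$, let the sequence $\{\mathbf{X}^n\}_{n\in\mathbb{N}_0}$ be a quasi-visual approximation of $(S,d)$, and let $\{\mathbf{Y}^n\}_{n\in\mathbb{N}_0}$ be the image of $\{\mathbf{X}^n\}$ under $\varphi$, that is, $\mathbf{Y}^n=\{\varphi(X):X\in\mathbf{X}^n\}$ for $n\in\mathbb{N}_0$. Then $\varphi$ is a quasisymmetry if and only if $\{\mathbf{Y}^n\}$ is a quasi-visual approximation of $(T,\varrho)$.
   Context: $\mathbb{N}_0=\{0,1,2,\dots\}$, $\mathbb{N}=\{1,2,\dots\}$. A bijection $\varphi\colon (S,d)\to (T,\varrho)$ is a quasisymmetry if there is a homeomorphism $\eta\colon[0,\infty)\to[0,\infty)$ with $\frac{\varrho(\varphi(x),\varphi(y))}{\varrho(\varphi(x),\varphi(z))}\le\eta\left(\frac{d(x,y)}{d(x,z)}\right)$ for all $x,y,z\in S$ with $x\ne z$. Let $\{\mathbf{X}^n\}_{n\in\mathbb{N}_0}$ be a sequence of covers of a set $S$ (each $\mathbf{X}^n$ is a collection, possibly infinite, of subsets of $S$ whose union is $S$). Elements of $\mathbf{X}^n$ are called $n$-tiles. For $X,Y\in\mathbf{X}^n$, a chain of $n$-tiles of length $k$ from $X$ to $Y$ is a finite sequence $X_0=X,X_1,\dots,X_k=Y$ of $n$-tiles with $X_j\cap X_{j+1}\ne\emptyset$ for all $j<k$. For $w\in\mathbb{N}_0$ and $X\in\mathbf{X}^n$,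 $U_w(X)$ is the union of all $Y\in\mathbf{X}^n$ for which there is a chain of $n$-tiles from $X$ to $Y$ of length $\le w$. Let $(S,d)$ be a bounded metric space with more than one point. A quasi-visual approximation of width $w\in\mathbb{N}_0$ of $(S,d)$ is a sequence $\{\mathbf{X}^n\}_{n\in\mathbb{N}_0}$ of covers of $S$ with $\mathbf{X}^0=\{S\}$ for which there are constants $C\ge1$, $k_0\in\mathbb{N}$, $\lambda\in(0,1)$ such that for all $n\in\mathbb{N}_0$: (i) $\frac1C\operatorname{diam}(Y)\le\operatorname{diam}(X)\le C\operatorname{diam}(Y)$ for all $X,Y\in\mathbf{X}^n$ with $X\cap Y\neq\emptyset$; (ii) $\operatorname{dist}(X,Y)\ge\frac1C\operatorname{diam}(X)$ for all $X,Y\in\mathbf{X}^n$ with $U_w(X)\cap U_w(Y)=\emptyset$; (iii) $\frac1C\operatorname{diam}(Y)\le\operatorname{diam}(X)\le C\operatorname{diam}(Y)$ for all $X\in\mathbf{X}^n$, $Y\in\mathbf{X}^{n+1}$ with $X\cap Y\ne\emptyset$; (iv) $\operatorname{diam}(Y)\le\lambda\operatorname{diam}(X)$ for all $X\in\mathbf{X}^n$, $Y\in\mathbf{X}^{n+k_0}$ with $X\cap Y\ne\emptyset$. Here $\operatorname{dist}(X,Y)=\inf\{d(x,y):x\in X,\,y\in Y\}$. "A quasi-visual approximation" without mention of width means one of some width $w\in\mathbb{N}_0$. *)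

theory Defs
  imports "HOL-Analysis.Analysis"
begin

text \<open>
  A metric space is given by a carrier set in a type of class \<open>metric_space\<close>, with the
  metric \<open>dist\<close> restricted to that set.  The two spaces of a map live in possibly
  different types, so their metrics are unrelated.
\<close>

definition quasisymmetry ::
  "'a::metric_space set \<Rightarrow> 'b::metric_space set \<Rightarrow> ('a \<Rightarrow> 'b) \<Rightarrow> bool" where
  "quasisymmetry S T \<phi> \<longleftrightarrow>
     bij_betw \<phi> S T \<and>
     (\<exists>\<eta> \<eta>' :: real \<Rightarrow> real. homeomorphism {0..} {0..} \<eta> \<eta>' \<and>
        (\<forall>x\<in>S. \<forall>y\<in>S. \<forall>z\<in>S. x \<noteq> z \<longrightarrow>
           dist (\<phi> x) (\<phi> y) / dist (\<phi> x) (\<phi> z) \<le> \<eta> (dist x y / dist x z)))"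

definition cover_of :: "'a set \<Rightarrow> 'a set set \<Rightarrow> bool" where
  "cover_of S \<X> \<longleftrightarrow> (\<forall>X\<in>\<X>. X \<subseteq> S) \<and> \<Union>\<X> = S"

definition tile_chain :: "'a set set \<Rightarrow> 'a set \<Rightarrow> 'a set \<Rightarrow> nat \<Rightarrow> bool" where
  "tile_chain \<X> X Y k \<longleftrightarrow>
     (\<exists>Z :: nat \<Rightarrow> 'a set. Z 0 = X \<and> Z k = Y \<and> (\<forall>j\<le>k. Z j \<in> \<X>) \<and>
        (\<forall>j<k. Z j \<inter> Z (Suc j) \<noteq> {}))"

definition tile_nbhd :: "'a set set \<Rightarrow> nat \<Rightarrow> 'a set \<Rightarrow> 'a set" where
  "tile_nbhd \<X> w X = \<Union>{Y \<in> \<X>. \<exists>k\<le>w. tile_chain \<X> X Y k}"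

text \<open>
  The empty set is not excluded as a tile.  The distance of the empty set to any set is
  \<open>inf \<emptyset> = \<infinity>\<close>, so the lower distance bound is vacuous if one of the tiles is empty; the
  nonemptiness premises below are needed because \<^const>\<open>setdist\<close> is \<open>0\<close> in that case.
\<close>

definition quasi_visual_approx_width ::
  "nat \<Rightarrow> 'a::metric_space set \<Rightarrow> (nat \<Rightarrow> 'a set set) \<Rightarrow> bool" where
  "quasi_visual_approx_width w S \<X> \<longleftrightarrow>
     bounded S \<and> (\<exists>x\<in>S. \<exists>y\<in>S. x \<noteq> y) \<and>
     (\<forall>n. cover_of S (\<X> n)) \<and> \<X> 0 = {S} \<and>
     (\<exists>(C::real) (k0::nat) (r::real). C \<ge> 1 \<and> k0 \<ge> 1 \<and> 0 < r \<and> r < 1 \<and>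
       (\<forall>n.
         (\<forall>X\<in>\<X> n. \<forall>Y\<in>\<X> n. X \<inter> Y \<noteq> {} \<longrightarrow>
            1 / C * diameter Y \<le> diameter X \<and> diameter X \<le> C * diameter Y) \<and>
         (\<forall>X\<in>\<X> n. \<forall>Y\<in>\<X> n. X \<noteq> {} \<longrightarrow> Y \<noteq> {} \<longrightarrow>
            tile_nbhd (\<X> n) w X \<inter> tile_nbhd (\<X> n) w Y = {} \<longrightarrow>
            setdist X Y \<ge> 1 / C * diameter X) \<and>
         (\<forall>X\<in>\<X> n. \<forall>Y\<in>\<X> (n + 1). X \<inter> Y \<noteq> {} \<longrightarrow>
            1 / C * diameter Y \<le> diameter X \<and> diameter X \<le> C * diameter Y) \<and>
         (\<forall>X\<in>\<X> n. \<forall>Y\<in>\<X> (n + k0). X \<inter> Y \<noteq> {} \<longrightarrow>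
            diameter Y \<le> r * diameter X)))"

definition quasi_visual_approx ::
  "'a::metric_space set \<Rightarrow> (nat \<Rightarrow> 'a set set) \<Rightarrow> bool" where
  "quasi_visual_approx S \<X> \<longleftrightarrow> (\<exists>w. quasi_visual_approx_width w S \<X>)"

end

theory Submission
  imports Defs
begin

text \<open>
  A quasi-visual approximation reads off the metric from combinatorial data.  For distinct
  \<open>x\<close> and \<open>y\<close> there is a level \<open>n\<close> at which the tiles around them have meeting \<open>w\<close>-neighborhoods
  while at level \<open>n + 1\<close> they no longer do (\<open>separation_level\<close>).  At such a level the distance of
  \<open>x\<close> and \<open>y\<close> is comparable to the diameter of any \<open>n\<close>-tile containing \<open>x\<close>
  (\<open>dist_le_if_linked\<close>, \<open>diameter_le_if_not_linked\<close>).  Moreover, along tiles containing a fixed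
  point the diameters shrink geometrically with the level, no slower than \<open>q ^ j\<close> up to a factor
  (\<open>geometric_decay\<close>) and no faster than \<open>C ^ (- j)\<close> (\<open>deeper_level_bounds\<close>).

  Suppose that the tiles and their images are both quasi-visual approximations; since widths can be
  enlarged (\<open>quasi_visual_wider\<close>), they may be taken of the same width.  The condition that singles
  out a level for a pair of points is combinatorial, so the same level serves the images of the two
  points.  For \<open>x, y, z\<close> with levels \<open>n\<close> and \<open>m\<close>, both
  \<open>dist x y / dist x z\<close> and the ratio of the image distances are therefore controlled from both
  sides by exponentials in \<open>m - n\<close>.  Comparing the exponentials bounds the image ratio by a
  multiple of \<open>max (t powr (1 / N)) (t ^ N)\<close> at the original ratio \<open>t\<close>
  (\<open>quasisymmetry_if_quasi_visual_image\<close>).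

  Conversely, a quasisymmetry distorts relative sizes in a controlled way: if two tiles share a
  point and one has diameter at most \<open>c\<close> times that of the other, then their images satisfy the
  same with \<open>2 * \<eta> (3 * c)\<close> in place of \<open>c\<close> (\<open>quasisymmetric_diameter_bound\<close>).  This gives the
  comparability conditions at once, and the contraction condition because \<open>\<eta>\<close> tends to \<open>0\<close> at
  \<open>0\<close>: after sufficiently many steps of contraction, the factor \<open>2 * \<eta> (3 * r ^ i)\<close> is at most
  \<open>1 / 2\<close>.  The separation condition is a direct estimate with the same width
  (\<open>quasi_visual_image_if_quasisymmetry\<close>).
\<close>

section \<open>Diameters\<close>

lemma diameter_le_twice_radius:
  fixes A :: "'a::metric_space set"
  assumes "bounded A" "0 \<le> d" and near_x: "\<And>z. z \<in> A \<Longrightarrow> dist x z \<le> d"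
  shows "diameter A \<le> 2 * d"
proof (rule ccontr)
  assume "\<not> diameter A \<le> 2 * d"
  then have *: "2 * d < diameter A" by simp
  then obtain e where e: "2 * d < e" "e < diameter A"
    using dense by blast
  obtain u v where "u \<in> A" "v \<in> A" "e < dist u v"
    using diameter_lower_bounded[OF \<open>bounded A\<close>, of e] e \<open>0 \<le> d\<close> by auto
  then show False
    using near_x[of u] near_x[of v] dist_triangle3[of u v x] e by linarith
qed

text \<open>
  Two points nearly realizing the diameter cannot both be close to \<open>x\<close>.  The factor \<open>3\<close> instead
  of \<open>2\<close> leaves room for the diameter not being attained.
\<close>
lemma exists_far_point:
  fixes A :: "'a::metric_space set"
  assumes "bounded A" "0 < diameter A" "x \<in> A"
  shows "\<exists>y\<in>A. y \<noteq> x \<and> diameter A \<le> 3 * dist x y"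
proof -
  obtain u v where uv: "u \<in> A" "v \<in> A" "2 / 3 * diameter A < dist u v"
    using diameter_lower_bounded[OF \<open>bounded A\<close>, of "2 / 3 * diameter A"] \<open>0 < diameter A\<close> by auto
  then have "diameter A \<le> 3 * dist x u \<or> diameter A \<le> 3 * dist x v"
    using dist_triangle3[of u v x] by linarith
  then show ?thesis
  proof
    assume "diameter A \<le> 3 * dist x u"
    then show ?thesis using uv(1) \<open>0 < diameter A\<close> by (intro bexI[of _ u]) auto
  next
    assume "diameter A \<le> 3 * dist x v"
    then show ?thesis using uv(2) \<open>0 < diameter A\<close> by (intro bexI[of _ v]) auto
  qed
qed

section \<open>Homeomorphisms of the half-line\<close>

text \<open>
  An injective continuous function on an interval is monotone.  Here it cannot decrease: it is
  nonnegative and attains \<open>0\<close>, and a decreasing function that attains \<open>0\<close> becomes negative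
  further to the right.
\<close>
lemma homeomorphism_halfline_mono:
  fixes \<eta> :: "real \<Rightarrow> real"
  assumes h: "homeomorphism {0..} {0..} \<eta> \<eta>'"
  shows "\<eta> 0 = 0" and "0 \<le> s \<Longrightarrow> s \<le> t \<Longrightarrow> \<eta> s \<le> \<eta> t"
proof -
  have inv: "\<eta>' (\<eta> t) = t" if "0 \<le> t" for t
    using homeomorphism_apply1[OF h] that by simp
  have nonneg: "0 \<le> \<eta> t" if "0 \<le> t" for t
    using imageI[of t "{0..}" \<eta>] homeomorphism_image1[OF h] that by simp
  have between: "\<eta> 0 < \<eta> s \<and> \<eta> s < \<eta> t \<or> \<eta> t < \<eta> s \<and> \<eta> s < \<eta> 0" if "0 < s" "s < t" for s t
  proof (rule continuous_inj_imp_mono[OF that])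
    show "continuous_on {0..t} \<eta>"
      by (rule continuous_on_subset[OF homeomorphism_cont1[OF h]]) auto
    show "inj_on \<eta> {0..t}"
      using inv by (intro inj_on_inverseI[of _ \<eta>']) simp
  qed
  obtain t0 where t0: "0 \<le> t0" "\<eta> t0 = 0"
    using imageI[of 0 "{0..}" \<eta>'] homeomorphism_image2[OF h] homeomorphism_apply2[OF h, of 0] by simp
  have "t0 = 0"
  proof (rule ccontr)
    assume "t0 \<noteq> 0"
    then show False
      using between[of t0 "t0 + 1"] t0 nonneg[of 0] nonneg[of "t0 + 1"] by auto
  qed
  then show zero: "\<eta> 0 = 0" using t0 by simp
  show "\<eta> s \<le> \<eta> t" if "0 \<le> s" "s \<le> t"
  proof (cases "s = 0 \<or> s = t")
    case True
    then show ?thesis using zero nonneg[of t] that by (elim disjE) simp_all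
  next
    case False
    then show ?thesis
      using between[of s t] nonneg[of s] zero that by simp
  qed
qed

text \<open>
  These are the distortion functions that come out of the comparison of two approximations.  The
  root dominates on \<open>[0, 1]\<close> and the power on \<open>[1, \<infinity>)\<close>; both pieces map their interval to
  itself, so the inverse exchanges their roles.
\<close>
lemma homeomorphism_max_root_power:
  fixes L :: real
  assumes N: "0 < N" and L: "0 < L"
  shows "homeomorphism {0..} {0..} (\<lambda>t. L * max (root N t) (t ^ N))
           (\<lambda>s. min ((s / L) ^ N) (root N (s / L)))"
proof -
  have below: "t ^ N \<le> t" "t \<le> root N t" if "0 \<le> t" "t \<le> 1" for t :: real
  proof -
    show p: "t ^ N \<le> t"
      using power_decreasing[of 1 N t] that N by simp
    show "t \<le> root N t"
      using real_root_le_mono[OF N p] real_root_power_cancel[OF N] that by simp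
  qed
  have above: "t \<le> t ^ N" "root N t \<le> t" if "1 \<le> t" for t :: real
  proof -
    show p: "t \<le> t ^ N"
      using power_increasing[of 1 N t] that N by simp
    show "root N t \<le> t"
      using real_root_le_mono[OF N p] real_root_power_cancel[OF N] that by simp
  qed
  have root_1: "root N t \<le> 1 \<longleftrightarrow> t \<le> 1" for t
    using N by simp
  have pow_1: "t ^ N \<le> 1 \<longleftrightarrow> t \<le> 1" if "0 \<le> t" for t :: real
    using N that by (simp add: power_le_one_iff)
  define f where "f t = max (root N t) (t ^ N)" for t
  define g where "g t = min (t ^ N) (root N t)" for t
  have f_low: "f t = root N t" and g_low: "g t = t ^ N" if "0 \<le> t" "t \<le> 1" for t
    using below[OF that] by (simp_all add: f_def g_def)
  have f_high: "f t = t ^ N" and g_high: "g t = root N t" if "1 \<le> t" for t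
    using above[OF that] by (simp_all add: f_def g_def)
  have gf: "g (f t) = t" if "0 \<le> t" for t
  proof (cases "t \<le> 1")
    case True
    then show ?thesis
      using that N root_1[of t] f_low[of t] g_low[of "root N t"] by simp
  next
    case False
    then show ?thesis
      using that N f_high[of t] g_high[of "t ^ N"] one_le_power[of t N]
      by (simp add: real_root_power_cancel)
  qed
  have fg: "f (g t) = t" if "0 \<le> t" for t
  proof (cases "t \<le> 1")
    case True
    then show ?thesis
      using that N pow_1[of t] g_low[of t] f_low[of "t ^ N"] by (simp add: real_root_power_cancel)
  next
    case False
    then show ?thesis
      using that N g_high[of t] f_high[of "root N t"] by simp
  qed
  have f_nonneg: "0 \<le> f t" and g_nonneg: "0 \<le> g t" if "0 \<le> t" for t
    using that N by (simp_all add: f_def g_def le_max_iff_disj)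
  have "homeomorphism {0..} {0..} (\<lambda>t. L * f t) (\<lambda>s. g (s / L))"
  proof (rule homeomorphismI)
    show "continuous_on {0..} (\<lambda>t. L * f t)"
      unfolding f_def by (intro continuous_intros)
    show "continuous_on {0..} (\<lambda>s. g (s / L))"
      unfolding g_def using L by (intro continuous_intros) simp_all
    show "(\<lambda>t. L * f t) ` {0..} \<subseteq> {0..}"
      using L by (intro image_subsetI) (simp add: f_nonneg)
    show "(\<lambda>s. g (s / L)) ` {0..} \<subseteq> {0..}"
      using L by (intro image_subsetI) (simp add: g_nonneg)
    show "g (L * f t / L) = t" if "t \<in> {0..}" for t
      using L that gf[of t] by simp
    show "L * f (g (s / L)) = s" if "s \<in> {0..}" for s
      using L that fg[of "s / L"] by simp
  qed
  then show ?thesis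
    unfolding f_def g_def .
qed

section \<open>Combinatorics of tiles\<close>

lemma cover_of_image:
  assumes "cover_of S \<X>"
  shows "cover_of (\<phi> ` S) ((`) \<phi> ` \<X>)"
  using assms unfolding cover_of_def by blast

text \<open>
  Incidence of tiles is invariant under an injection: chains of images are pulled back by taking
  preimages within \<open>S\<close>, which recovers the original tiles.
\<close>
lemma tile_chain_image_iff:
  assumes inj: "inj_on \<phi> S" and cover: "cover_of S \<X>" and XY: "X \<in> \<X>" "Y \<in> \<X>"
  shows "tile_chain ((`) \<phi> ` \<X>) (\<phi> ` X) (\<phi> ` Y) k \<longleftrightarrow> tile_chain \<X> X Y k"
proof
  assume "tile_chain \<X> X Y k"
  then obtain Z where Z: "Z 0 = X" "Z k = Y" "\<forall>j\<le>k. Z j \<in> \<X>" "\<forall>j<k. Z j \<inter> Z (Suc j) \<noteq> {}"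
    unfolding tile_chain_def by blast
  show "tile_chain ((`) \<phi> ` \<X>) (\<phi> ` X) (\<phi> ` Y) k"
    unfolding tile_chain_def
  proof (intro exI[of _ "\<lambda>j. \<phi> ` Z j"] conjI allI impI)
    fix j assume "j < k"
    then obtain p where "p \<in> Z j" "p \<in> Z (Suc j)" using Z(4) by blast
    then show "\<phi> ` Z j \<inter> \<phi> ` Z (Suc j) \<noteq> {}" by blast
  qed (use Z in auto)
next
  assume "tile_chain ((`) \<phi> ` \<X>) (\<phi> ` X) (\<phi> ` Y) k"
  then obtain Z where Z: "Z 0 = \<phi> ` X" "Z k = \<phi> ` Y" "\<forall>j\<le>k. Z j \<in> (`) \<phi> ` \<X>"
      "\<forall>j<k. Z j \<inter> Z (Suc j) \<noteq> {}"
    unfolding tile_chain_def by blast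
  define W where "W j = S \<inter> \<phi> -` Z j" for j
  have pullback: "S \<inter> \<phi> -` (\<phi> ` A) = A" if "A \<in> \<X>" for A
  proof -
    have "A \<subseteq> S" using cover that unfolding cover_of_def by simp
    then show ?thesis using inj_on_image_mem_iff[OF inj] by auto
  qed
  show "tile_chain \<X> X Y k"
    unfolding tile_chain_def
  proof (intro exI[of _ W] conjI allI impI)
    show "W 0 = X" "W k = Y"
      by (simp_all add: W_def Z(1,2) pullback XY)
    show "W j \<in> \<X>" if "j \<le> k" for j
    proof -
      have "Z j \<in> (`) \<phi> ` \<X>" using Z(3) that by simp
      then obtain A where "A \<in> \<X>" "Z j = \<phi> ` A" by (rule imageE)
      then show ?thesis by (simp add: W_def pullback)
    qed
    show "W j \<inter> W (Suc j) \<noteq> {}" if j: "j < k" for j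
    proof -
      have "Z j \<in> (`) \<phi> ` \<X>" using Z(3) j by simp
      then obtain A where A: "A \<in> \<X>" "Z j = \<phi> ` A" by (rule imageE)
      have "Z j \<inter> Z (Suc j) \<noteq> {}" using Z(4) j by simp
      then obtain x where "x \<in> A" "\<phi> x \<in> Z j" "\<phi> x \<in> Z (Suc j)"
        using A(2) by auto
      then have "x \<in> W j \<inter> W (Suc j)"
        using A(1) cover by (auto simp: W_def cover_of_def)
      then show ?thesis by blast
    qed
  qed
qed

lemma tile_nbhd_image:
  assumes "inj_on \<phi> S" "cover_of S \<X>" "X \<in> \<X>"
  shows "tile_nbhd ((`) \<phi> ` \<X>) w (\<phi> ` X) = \<phi> ` tile_nbhd \<X> w X"
proof -
  have "{Y \<in> (`) \<phi> ` \<X>. \<exists>k\<le>w. tile_chain ((`) \<phi> ` \<X>) (\<phi> ` X) Y k}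
      = (`) \<phi> ` {Y \<in> \<X>. \<exists>k\<le>w. tile_chain \<X> X Y k}"
    using tile_chain_image_iff[OF assms] by auto
  then show ?thesis
    unfolding tile_nbhd_def by (simp add: image_Union)
qed

lemma tile_nbhds_disjoint_image_iff:
  assumes inj: "inj_on \<phi> S" and cover: "cover_of S \<X>" and "X \<in> \<X>" "Y \<in> \<X>"
  shows "tile_nbhd ((`) \<phi> ` \<X>) w (\<phi> ` X) \<inter> tile_nbhd ((`) \<phi> ` \<X>) w (\<phi> ` Y) = {}
    \<longleftrightarrow> tile_nbhd \<X> w X \<inter> tile_nbhd \<X> w Y = {}"
proof -
  have sub: "tile_nbhd \<X> w Z \<subseteq> S" for Z
    using cover unfolding tile_nbhd_def cover_of_def by blast
  show ?thesis
    by (simp only: tile_nbhd_image[OF inj cover] assms image_is_empty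
        inj_on_image_Int[OF inj sub sub, symmetric])
qed

lemma tile_nbhd_mono: "v \<le> w \<Longrightarrow> tile_nbhd \<X> v X \<subseteq> tile_nbhd \<X> w X"
  unfolding tile_nbhd_def using le_trans by blast

text \<open>
  The points are not separated at level \<open>n\<close>.  Only the incidences of tiles enter, hence
  injective maps preserve this relation.
\<close>
definition linked :: "(nat \<Rightarrow> 'a set set) \<Rightarrow> nat \<Rightarrow> nat \<Rightarrow> 'a \<Rightarrow> 'a \<Rightarrow> bool" where
  "linked \<X> w n x y \<longleftrightarrow> (\<exists>X\<in>\<X> n. \<exists>Y\<in>\<X> n. x \<in> X \<and> y \<in> Y \<and>
      tile_nbhd (\<X> n) w X \<inter> tile_nbhd (\<X> n) w Y \<noteq> {})"

lemma linked_image_iff: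
  assumes inj: "inj_on \<phi> S" and cover: "cover_of S (\<X> n)" and S: "x \<in> S" "y \<in> S"
  shows "linked (\<lambda>n. (`) \<phi> ` \<X> n) w n (\<phi> x) (\<phi> y) \<longleftrightarrow> linked \<X> w n x y"
proof -
  have mem: "\<phi> z \<in> \<phi> ` X \<longleftrightarrow> z \<in> X" if "z \<in> S" "X \<in> \<X> n" for z X
    using inj cover that inj_on_image_mem_iff unfolding cover_of_def by metis
  show ?thesis
    unfolding linked_def
    by (simp add: mem S tile_nbhds_disjoint_image_iff[OF inj cover] cong: bex_cong)
qed

section \<open>Quasi-visual approximations with given constants\<close>

text \<open>
  The constants are parameters so that two approximations with different constants can be
  compared.  All two-sided bounds are turned into upper bounds without division; for tiles of the
  same level one of them is enough, by symmetry.
\<close>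
locale quasi_visual =
  fixes w :: nat and S :: "'a::metric_space set" and \<X> :: "nat \<Rightarrow> 'a set set"
    and C :: real and k0 :: nat and r :: real
  assumes bounded_space: "bounded S"
    and two_points: "\<exists>x\<in>S. \<exists>y\<in>S. x \<noteq> y"
    and cover: "cover_of S (\<X> n)"
    and tiles_0: "\<X> 0 = {S}"
    and C_ge_1: "1 \<le> C" and k0_ge_1: "1 \<le> k0" and r_pos: "0 < r" and r_less_1: "r < 1"
    and same_level: "X \<in> \<X> n \<Longrightarrow> Y \<in> \<X> n \<Longrightarrow> X \<inter> Y \<noteq> {} \<Longrightarrow> diameter X \<le> C * diameter Y"
    and separated: "X \<in> \<X> n \<Longrightarrow> Y \<in> \<X> n \<Longrightarrow> X \<noteq> {} \<Longrightarrow> Y \<noteq> {} \<Longrightarrow>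
      tile_nbhd (\<X> n) w X \<inter> tile_nbhd (\<X> n) w Y = {} \<Longrightarrow> diameter X \<le> C * setdist X Y"
    and next_level_le: "X \<in> \<X> n \<Longrightarrow> Y \<in> \<X> (Suc n) \<Longrightarrow> X \<inter> Y \<noteq> {} \<Longrightarrow> diameter Y \<le> C * diameter X"
    and next_level_ge: "X \<in> \<X> n \<Longrightarrow> Y \<in> \<X> (Suc n) \<Longrightarrow> X \<inter> Y \<noteq> {} \<Longrightarrow> diameter X \<le> C * diameter Y"
    and shrink: "X \<in> \<X> n \<Longrightarrow> Y \<in> \<X> (n + k0) \<Longrightarrow> X \<inter> Y \<noteq> {} \<Longrightarrow> diameter Y \<le> r * diameter X"

lemma quasi_visual_approx_width_iff:
  "quasi_visual_approx_width w S \<X> \<longleftrightarrow> (\<exists>C k0 r. quasi_visual w S \<X> C k0 r)"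
proof
  assume "quasi_visual_approx_width w S \<X>"
  then show "\<exists>C k0 r. quasi_visual w S \<X> C k0 r"
    unfolding quasi_visual_approx_width_def
  proof (elim conjE exE, goal_cases)
    case (1 C k0 r)
    have mult: "1 / C * a \<le> b \<longleftrightarrow> a \<le> C * b" for a b :: real
      using \<open>1 \<le> C\<close> by (simp add: field_simps)
    note level = spec[OF 1(9), unfolded mult]
    note same_level = level[THEN conjunct1, rule_format]
      and separated = level[THEN conjunct2, THEN conjunct1, rule_format]
      and next_level = level[THEN conjunct2, THEN conjunct2, THEN conjunct1, rule_format]
      and shrink = level[THEN conjunct2, THEN conjunct2, THEN conjunct2, rule_format]
    have "quasi_visual w S \<X> C k0 r"
      using 1(1-8) same_level separated next_level shrink
      by (intro quasi_visual.intro) (simp_all)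
    then show ?case by blast
  qed
next
  assume "\<exists>C k0 r. quasi_visual w S \<X> C k0 r"
  then obtain C k0 r where "quasi_visual w S \<X> C k0 r" by blast
  then interpret quasi_visual w S \<X> C k0 r .
  have mult: "1 / C * a \<le> b \<longleftrightarrow> a \<le> C * b" for a b :: real
    using C_ge_1 by (simp add: field_simps)
  show "quasi_visual_approx_width w S \<X>"
    unfolding quasi_visual_approx_width_def
  proof (intro conjI; (rule exI[of _ C], rule exI[of _ k0], rule exI[of _ r], intro conjI allI ballI impI)?)
    show "1 / C * diameter Y \<le> diameter X" if "X \<in> \<X> n" "Y \<in> \<X> n" "X \<inter> Y \<noteq> {}" for X Y n
      unfolding mult using same_level[of Y n X] that by (simp add: Int_commute)
    show "diameter X \<le> C * diameter Y" if "X \<in> \<X> n" "Y \<in> \<X> n" "X \<inter> Y \<noteq> {}" for X Y n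
      using same_level[OF that] .
  qed (unfold mult, use bounded_space two_points cover tiles_0 C_ge_1 k0_ge_1 r_pos r_less_1
      separated next_level_le next_level_ge shrink in simp_all)
qed

context quasi_visual
begin

text \<open>
  Larger neighborhoods are disjoint less often, so the separation condition weakens as the width
  grows.
\<close>
lemma quasi_visual_wider:
  assumes "w \<le> w'"
  shows "quasi_visual w' S \<X> C k0 r"
proof -
  have "diameter X \<le> C * setdist X Y"
    if "X \<in> \<X> n" "Y \<in> \<X> n" "X \<noteq> {}" "Y \<noteq> {}"
      "tile_nbhd (\<X> n) w' X \<inter> tile_nbhd (\<X> n) w' Y = {}" for X n Y
  proof -
    have "tile_nbhd (\<X> n) w X \<inter> tile_nbhd (\<X> n) w Y = {}"
      using tile_nbhd_mono[OF assms, of "\<X> n"] that(5) by blast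
    then show ?thesis using separated that by blast
  qed
  note separated' = this
  show ?thesis
    by (rule quasi_visual.intro)
      (fact bounded_space two_points cover tiles_0 C_ge_1 k0_ge_1 r_pos r_less_1
        same_level separated' next_level_le next_level_ge shrink)+
qed

lemma tile_subset: "X \<in> \<X> n \<Longrightarrow> X \<subseteq> S"
  using cover[of n] unfolding cover_of_def by simp

lemma tile_bounded: "X \<in> \<X> n \<Longrightarrow> bounded X"
  using tile_subset[of X n] bounded_subset[OF bounded_space] by simp

lemma dist_le_diameter: "X \<in> \<X> n \<Longrightarrow> x \<in> X \<Longrightarrow> y \<in> X \<Longrightarrow> dist x y \<le> diameter X"
  using tile_bounded[of X n] diameter_bounded_bound[of X x y] by simp

lemma diameter_nonneg: "X \<in> \<X> n \<Longrightarrow> 0 \<le> diameter X"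
  using tile_bounded[of X n] diameter_ge_0[of X] by simp

lemma exists_tile: "x \<in> S \<Longrightarrow> \<exists>X\<in>\<X> n. x \<in> X"
  using cover[of n] unfolding cover_of_def by blast

lemma diameter_space_pos: "0 < diameter S"
proof -
  obtain x y where "x \<in> S" "y \<in> S" "x \<noteq> y" using two_points by blast
  then show ?thesis
    using diameter_bounded_bound[OF bounded_space, of x y] by (metis dist_pos_lt less_le_trans)
qed

text \<open>
  Positivity is inherited from the whole space, the only tile of level \<open>0\<close>, since consecutive
  levels have comparable diameters.
\<close>
lemma diameter_pos: "X \<in> \<X> n \<Longrightarrow> x \<in> X \<Longrightarrow> 0 < diameter X"
proof (induction n arbitrary: X)
  case 0
  then show ?case using tiles_0 diameter_space_pos by simp
next
  case (Suc n)
  then obtain Y where Y: "Y \<in> \<X> n" "x \<in> Y"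
    using exists_tile tile_subset by blast
  then have "0 < C * diameter X"
    using Suc.IH next_level_ge[of Y n X] Suc.prems by fastforce
  then show ?case
    using C_ge_1 by (simp add: zero_less_mult_iff)
qed

lemma deeper_level_bounds:
  assumes "X \<in> \<X> n" "x \<in> X" "Y \<in> \<X> (n + j)" "x \<in> Y"
  shows "diameter X \<le> C ^ Suc j * diameter Y" and "diameter Y \<le> C ^ Suc j * diameter X"
proof -
  have "diameter X \<le> C ^ Suc j * diameter Y \<and> diameter Y \<le> C ^ Suc j * diameter X"
    using assms(3,4)
  proof (induction j arbitrary: Y)
    case 0
    then show ?case
      using same_level[of X n Y] same_level[of Y n X] assms by auto
  next
    case (Suc j)
    obtain Z where Z: "Z \<in> \<X> (n + j)" "x \<in> Z"
      using exists_tile tile_subset assms by blast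
    have ZY: "diameter Y \<le> C * diameter Z" "diameter Z \<le> C * diameter Y"
      using next_level_le[of Z "n + j" Y] next_level_ge[of Z "n + j" Y] Z Suc.prems by auto
    have "diameter X \<le> C ^ Suc j * (C * diameter Y)"
      using order_trans[OF conjunct1[OF Suc.IH[OF Z]] mult_left_mono[OF ZY(2), of "C ^ Suc j"]] C_ge_1
      by simp
    moreover have "diameter Y \<le> C * (C ^ Suc j * diameter X)"
      using Suc.IH[OF Z] mult_left_mono[of "diameter Z" "C ^ Suc j * diameter X" C] ZY C_ge_1
      by linarith
    ultimately show ?case by (simp add: mult_ac)
  qed
  then show "diameter X \<le> C ^ Suc j * diameter Y" "diameter Y \<le> C ^ Suc j * diameter X" by auto
qed

text \<open>
  A point of the intersection is kept fixed, so that at each intermediate level there is a tile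
  meeting both its predecessor and its successor.
\<close>
lemma iterated_shrink:
  assumes "X \<in> \<X> n" "x \<in> X" "Y \<in> \<X> (n + k0 * i)" "x \<in> Y" "0 < i"
  shows "diameter Y \<le> r ^ i * diameter X"
proof -
  have "\<And>Y. Y \<in> \<X> (n + k0 * Suc i) \<Longrightarrow> x \<in> Y \<Longrightarrow> diameter Y \<le> r ^ Suc i * diameter X" for i
  proof (induction i)
    case 0
    then show ?case using shrink[of X n Y] assms by auto
  next
    case (Suc i)
    obtain Z where Z: "Z \<in> \<X> (n + k0 * Suc i)" "x \<in> Z"
      using exists_tile tile_subset assms by blast
    have "diameter Y \<le> r * diameter Z"
      using shrink[of Z "n + k0 * Suc i" Y] Suc.prems Z by (auto simp: algebra_simps)
    also have "\<dots> \<le> r * (r ^ Suc i * diameter X)"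
      using Suc.IH[OF Z] r_pos by (intro mult_left_mono) auto
    finally show ?case by (simp add: mult_ac)
  qed
  from this[of Y "i - 1"] show ?thesis using assms by simp
qed

text \<open>
  Contraction is only given in steps of \<open>k0\<close> levels.  With \<open>q ^ k0 = r\<close>, the at most \<open>k0 - 1\<close>
  remaining levels cost a bounded factor.
\<close>
lemma geometric_decay:
  obtains A q where "1 \<le> A" "0 < q" "q < 1"
    "\<And>X n x Y j. X \<in> \<X> n \<Longrightarrow> x \<in> X \<Longrightarrow> Y \<in> \<X> (n + j) \<Longrightarrow> x \<in> Y \<Longrightarrow> diameter Y \<le> A * q ^ j * diameter X"
proof
  define q where "q = root k0 r"
  have q_pow: "q ^ k0 = r"
    using k0_ge_1 r_pos by (simp add: q_def)
  show q: "0 < q" "q < 1"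
    using k0_ge_1 r_pos r_less_1 by (auto simp: q_def)
  show "1 \<le> C ^ Suc k0 * C / r"
    using C_ge_1 r_pos r_less_1 mult_mono[of 1 "C ^ Suc k0" 1 C] by (simp add: one_le_power del: power_Suc)
  fix X n x Y j
  assume *: "X \<in> \<X> n" "x \<in> X" "Y \<in> \<X> (n + j)" "x \<in> Y"
  define i where "i = j div k0"
  define s where "s = j mod k0"
  have j: "j = k0 * i + s" and s: "s < k0"
    using k0_ge_1 by (auto simp: i_def s_def)
  obtain Z where Z: "Z \<in> \<X> (n + k0 * i)" "x \<in> Z"
    using exists_tile tile_subset * by blast
  have "diameter Y \<le> C ^ Suc s * diameter Z"
    using deeper_level_bounds(2)[OF Z, of Y s] * by (simp add: j add.assoc)
  also have "\<dots> \<le> C ^ Suc k0 * diameter Z"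
    using C_ge_1 s diameter_nonneg[OF Z(1)] by (intro mult_right_mono power_increasing) auto
  also have "\<dots> \<le> C ^ Suc k0 * (C * (r ^ i * diameter X))"
  proof (intro mult_left_mono)
    have "0 \<le> r ^ i * diameter X"
      using r_pos diameter_nonneg[OF *(1)] by simp
    then have le: "r ^ i * diameter X \<le> C * (r ^ i * diameter X)"
      using C_ge_1 by (simp add: mult_le_cancel_right1)
    show "diameter Z \<le> C * (r ^ i * diameter X)"
    proof (cases "i = 0")
      case True
      then show ?thesis using same_level[of Z n X] Z * by auto
    next
      case False
      then show ?thesis using iterated_shrink[OF *(1,2) Z] le by simp
    qed
    show "0 \<le> C ^ Suc k0" using C_ge_1 by simp
  qed
  also have "\<dots> \<le> C ^ Suc k0 * (C * (q ^ j / r * diameter X))"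
  proof (intro mult_left_mono mult_right_mono)
    have "r \<le> q ^ s"
      using q s power_decreasing[of s k0 q] by (simp add: q_pow)
    then have "r ^ i * r \<le> r ^ i * q ^ s"
      using r_pos by (intro mult_left_mono) auto
    also have "\<dots> = q ^ j"
      by (simp add: j power_add power_mult q_pow)
    finally show "r ^ i \<le> q ^ j / r"
      using r_pos by (simp add: field_simps)
  qed (use C_ge_1 diameter_nonneg[OF *(1)] in auto)
  finally show "diameter Y \<le> C ^ Suc k0 * C / r * q ^ j * diameter X"
    by (simp add: mult_ac)
qed

text \<open>
  Diameters change by at most the factor \<open>C\<close> from one tile of a chain to the next, and the
  distance from \<open>x\<close> to any point of the chain is at most the sum of the diameters along it.
\<close>
lemma chain_bounds:
  assumes "tile_chain (\<X> n) X Y k" "x \<in> X" "y \<in> Y"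
  shows "diameter Y \<le> C ^ k * diameter X" "diameter X \<le> C ^ k * diameter Y"
    "dist x y \<le> (real k + 1) * C ^ k * diameter X"
proof -
  obtain Z where Z: "Z 0 = X" "Z k = Y" "\<And>j. j \<le> k \<Longrightarrow> Z j \<in> \<X> n"
      "\<And>j. j < k \<Longrightarrow> Z j \<inter> Z (Suc j) \<noteq> {}"
    using assms unfolding tile_chain_def by blast
  have "i \<le> k \<Longrightarrow> z \<in> Z i \<Longrightarrow> diameter (Z i) \<le> C ^ i * diameter X \<and> diameter X \<le> C ^ i * diameter (Z i)
      \<and> dist x z \<le> (real i + 1) * C ^ i * diameter X" for i z
  proof (induction i arbitrary: z)
    case 0
    then show ?case using dist_le_diameter[of X n x z] Z(1) Z(3)[of 0] assms by auto
  next
    case (Suc i)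
    obtain p where p: "p \<in> Z i" "p \<in> Z (Suc i)" using Z(4)[of i] Suc.prems by auto
    have tiles: "Z i \<in> \<X> n" "Z (Suc i) \<in> \<X> n" using Z(3) Suc.prems by auto
    have IH: "diameter (Z i) \<le> C ^ i * diameter X" "diameter X \<le> C ^ i * diameter (Z i)"
        "dist x p \<le> (real i + 1) * C ^ i * diameter X"
      using Suc.IH[OF _ p(1)] Suc.prems by auto
    have adj: "diameter (Z (Suc i)) \<le> C * diameter (Z i)" "diameter (Z i) \<le> C * diameter (Z (Suc i))"
      using same_level tiles p by blast+
    have X0: "0 \<le> diameter X" using diameter_nonneg[OF Z(3)[of 0]] Z(1) by simp
    have 1: "diameter (Z (Suc i)) \<le> C ^ Suc i * diameter X"
      using order_trans[OF adj(1) mult_left_mono[OF IH(1), of C]] C_ge_1 by (simp add: mult.assoc)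
    have 2: "diameter X \<le> C ^ Suc i * diameter (Z (Suc i))"
      using order_trans[OF IH(2) mult_left_mono[OF adj(2), of "C ^ i"]] C_ge_1 by (simp add: mult_ac)
    have "dist x z \<le> dist x p + dist p z" by (rule dist_triangle)
    also have "\<dots> \<le> (real i + 1) * C ^ i * diameter X + C ^ Suc i * diameter X"
      using IH(3) 1 dist_le_diameter[OF tiles(2) p(2) Suc.prems(2)] by linarith
    also have "\<dots> \<le> (real i + 1) * C ^ Suc i * diameter X + C ^ Suc i * diameter X"
      using C_ge_1 X0 by (intro add_right_mono mult_right_mono mult_left_mono power_increasing) auto
    finally have "dist x z \<le> (real (Suc i) + 1) * C ^ Suc i * diameter X"
      by (simp add: algebra_simps)
    with 1 2 show ?case by simp
  qed
  from this[of k y] show "diameter Y \<le> C ^ k * diameter X" "diameter X \<le> C ^ k * diameter Y"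
    "dist x y \<le> (real k + 1) * C ^ k * diameter X"
    using Z(2) assms by auto
qed

lemma nbhd_bounds:
  assumes "X \<in> \<X> n" "x \<in> X" "p \<in> tile_nbhd (\<X> n) w X"
  obtains Z where "Z \<in> \<X> n" "p \<in> Z" "diameter Z \<le> C ^ w * diameter X"
    "diameter X \<le> C ^ w * diameter Z" "dist x p \<le> (real w + 1) * C ^ w * diameter X"
proof -
  obtain Z k where Z: "Z \<in> \<X> n" "p \<in> Z" "k \<le> w" "tile_chain (\<X> n) X Z k"
    using assms unfolding tile_nbhd_def by blast
  have pow: "C ^ k \<le> C ^ w" using Z(3) C_ge_1 by (simp add: power_increasing)
  have D: "0 \<le> diameter X" "0 \<le> diameter Z" using diameter_nonneg assms Z by auto
  note b = chain_bounds[OF Z(4) assms(2) Z(2)]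
  have "diameter Z \<le> C ^ w * diameter X" "diameter X \<le> C ^ w * diameter Z"
    using b(1,2) mult_right_mono[OF pow D(1)] mult_right_mono[OF pow D(2)] by linarith+
  moreover have "(real k + 1) * C ^ k * diameter X \<le> (real w + 1) * C ^ w * diameter X"
    using pow Z(3) D C_ge_1 by (intro mult_right_mono mult_mono) auto
  ultimately show thesis using that Z b(3) by (meson order_trans)
qed

text \<open>
  The points are joined through two chains of length at most \<open>w\<close> that end in tiles sharing the
  point \<open>p\<close>.
\<close>
lemma dist_le_if_linked:
  obtains K where "1 \<le> K"
    "\<And>n x y X. linked \<X> w n x y \<Longrightarrow> X \<in> \<X> n \<Longrightarrow> x \<in> X \<Longrightarrow> dist x y \<le> K * diameter X"
proof
  define M where "M = (real w + 1) * C ^ w"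
  have pw: "1 \<le> C ^ w" using C_ge_1 by simp
  have M: "1 \<le> M" unfolding M_def using mult_mono[of 1 "real w + 1" 1 "C ^ w"] pw by (simp add: add.commute)
  have B: "1 \<le> C ^ w * C * C ^ w"
    using mult_mono[OF mult_mono[OF pw C_ge_1] pw] pw C_ge_1 by simp
  show "1 \<le> (M + M * (C ^ w * C * C ^ w)) * C"
    using mult_mono[of 1 "M + M * (C ^ w * C * C ^ w)" 1 C] mult_mono[OF M B] M C_ge_1 by simp
  fix n x y X
  assume "linked \<X> w n x y" and X: "X \<in> \<X> n" "x \<in> X"
  then obtain X' Y p where *: "X' \<in> \<X> n" "Y \<in> \<X> n" "x \<in> X'" "y \<in> Y"
      "p \<in> tile_nbhd (\<X> n) w X'" "p \<in> tile_nbhd (\<X> n) w Y"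
    unfolding linked_def by blast
  obtain Z where Z: "Z \<in> \<X> n" "p \<in> Z" "diameter Z \<le> C ^ w * diameter X'"
    "dist x p \<le> (real w + 1) * C ^ w * diameter X'"
    using nbhd_bounds[OF *(1,3,5)] by metis
  obtain Z' where Z': "Z' \<in> \<X> n" "p \<in> Z'" "diameter Y \<le> C ^ w * diameter Z'"
    "dist y p \<le> (real w + 1) * C ^ w * diameter Y"
    using nbhd_bounds[OF *(2,4,6)] by metis
  have ZZ': "diameter Z' \<le> C * diameter Z"
    using same_level Z Z' by blast
  have Y: "diameter Y \<le> C ^ w * C * C ^ w * diameter X'"
  proof -
    have "C * diameter Z \<le> C * (C ^ w * diameter X')"
      using Z C_ge_1 by (intro mult_left_mono) auto
    then have "C ^ w * diameter Z' \<le> C ^ w * (C * (C ^ w * diameter X'))"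
      using ZZ' C_ge_1 by (intro mult_left_mono order_trans[OF ZZ']) auto
    then show ?thesis using Z'(3) by (simp add: mult_ac)
  qed
  have "dist x y \<le> dist x p + dist y p" by (rule dist_triangle2)
  also have "\<dots> \<le> M * diameter X' + M * (C ^ w * C * C ^ w * diameter X')"
    using Z(4) Z'(4) mult_left_mono[OF Y, of M] M unfolding M_def by linarith
  also have "\<dots> = (M + M * (C ^ w * C * C ^ w)) * diameter X'"
    by (simp add: algebra_simps)
  also have "\<dots> \<le> (M + M * (C ^ w * C * C ^ w)) * (C * diameter X)"
    using M B same_level[of X' n X] * X by (intro mult_left_mono) auto
  finally show "dist x y \<le> (M + M * (C ^ w * C * C ^ w)) * C * diameter X"
    by (simp add: mult_ac)
qed

text \<open>
  Separation at level \<open>n + 1\<close> bounds the distance below by the diameter of an \<open>(n + 1)\<close>-tile; one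
  factor \<open>C\<close> stems from this bound and the other from passing to level \<open>n\<close>.
\<close>
lemma diameter_le_if_not_linked:
  assumes "\<not> linked \<X> w (Suc n) x y" "X \<in> \<X> n" "x \<in> X" "y \<in> S"
  shows "diameter X \<le> C * C * dist x y"
proof -
  obtain X' where X': "X' \<in> \<X> (Suc n)" "x \<in> X'"
    using exists_tile tile_subset assms by blast
  obtain Y' where Y': "Y' \<in> \<X> (Suc n)" "y \<in> Y'"
    using exists_tile assms by blast
  have "tile_nbhd (\<X> (Suc n)) w X' \<inter> tile_nbhd (\<X> (Suc n)) w Y' = {}"
    using assms(1) X' Y' unfolding linked_def by blast
  then have "diameter X' \<le> C * setdist X' Y'"
    using separated X' Y' by blast
  also have "\<dots> \<le> C * dist x y"
    using setdist_le_dist[OF X'(2) Y'(2)] C_ge_1 by (intro mult_left_mono) auto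
  finally have *: "diameter X' \<le> C * dist x y" .
  have "diameter X \<le> C * diameter X'"
    using next_level_ge[of X n X'] assms X' by blast
  also have "\<dots> \<le> C * (C * dist x y)"
    using * C_ge_1 by (intro mult_left_mono) auto
  finally show ?thesis by (simp add: mult_ac)
qed

text \<open>
  All points are linked at level \<open>0\<close>.  Points linked at every level would have distance \<open>0\<close>,
  because the diameters of tiles tend to \<open>0\<close>.
\<close>
lemma separation_level:
  assumes "x \<in> S" "y \<in> S" "x \<noteq> y"
  obtains n where "linked \<X> w n x y" "\<not> linked \<X> w (Suc n) x y"
proof -
  have "linked \<X> w 0 x y"
  proof -
    have "tile_chain (\<X> 0) S S 0"
      unfolding tile_chain_def using tiles_0 by auto
    then have "S \<subseteq> tile_nbhd (\<X> 0) w S"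
      unfolding tile_nbhd_def using tiles_0 by blast
    then show ?thesis
      unfolding linked_def using tiles_0 assms by auto
  qed
  moreover have "\<exists>n. \<not> linked \<X> w n x y"
  proof (rule ccontr)
    assume "\<nexists>n. \<not> linked \<X> w n x y"
    then have all: "linked \<X> w n x y" for n by blast
    obtain K where K: "1 \<le> K"
      "\<And>n x y X. linked \<X> w n x y \<Longrightarrow> X \<in> \<X> n \<Longrightarrow> x \<in> X \<Longrightarrow> dist x y \<le> K * diameter X"
      using dist_le_if_linked by metis
    obtain A q where A: "1 \<le> A" "0 < q" "q < 1"
      "\<And>X n x Y j. X \<in> \<X> n \<Longrightarrow> x \<in> X \<Longrightarrow> Y \<in> \<X> (n + j) \<Longrightarrow> x \<in> Y \<Longrightarrow> diameter Y \<le> A * q ^ j * diameter X"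
      using geometric_decay by metis
    have "dist x y \<le> K * (A * q ^ j * diameter S)" for j
    proof -
      obtain X where X: "X \<in> \<X> j" "x \<in> X" using exists_tile assms by blast
      have "dist x y \<le> K * diameter X" using K(2)[OF all X] .
      also have "\<dots> \<le> K * (A * q ^ j * diameter S)"
        using A(4)[of S 0 x X j] tiles_0 X assms K(1) by (intro mult_left_mono) auto
      finally show ?thesis .
    qed
    moreover have "(\<lambda>j. K * (A * q ^ j * diameter S)) \<longlonglongrightarrow> K * (A * 0 * diameter S)"
      using A by (intro tendsto_intros LIMSEQ_power_zero) auto
    ultimately have "dist x y \<le> K * (A * 0 * diameter S)"
      by (intro LIMSEQ_le_const) auto
    then show False using assms by simp
  qed
  ultimately show thesis
    using that nat_induct[of "\<lambda>n. linked \<X> w n x y"] by blast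
qed

end

section \<open>Quasisymmetries preserve quasi-visual approximations\<close>

text \<open>
  The set \<open>X\<close> contains a point \<open>y\<close> with \<open>diameter X \<le> 3 * dist x y\<close>, against which all distances
  from \<open>x\<close> to points of \<open>Y\<close> are compared.  The factor \<open>2\<close> converts a radius about \<open>\<phi> x\<close> into a
  diameter.
\<close>
lemma quasisymmetric_diameter_bound:
  fixes \<phi> :: "'a::metric_space \<Rightarrow> 'b::metric_space"
  assumes \<eta>: "homeomorphism {0..} {0..} \<eta> \<eta>'"
    and qs: "\<And>x y z. x \<in> S \<Longrightarrow> y \<in> S \<Longrightarrow> z \<in> S \<Longrightarrow> x \<noteq> z \<Longrightarrow>
       dist (\<phi> x) (\<phi> y) / dist (\<phi> x) (\<phi> z) \<le> \<eta> (dist x y / dist x z)"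
    and inj: "inj_on \<phi> S" and bdd: "bounded S" "bounded (\<phi> ` S)"
    and X: "X \<subseteq> S" "0 < diameter X" "x \<in> X" and Y: "Y \<subseteq> S" "x \<in> Y"
    and le: "diameter Y \<le> c * diameter X" "0 \<le> c"
  shows "diameter (\<phi> ` Y) \<le> 2 * \<eta> (3 * c) * diameter (\<phi> ` X)"
proof -
  have bX: "bounded X" "bounded Y" "bounded (\<phi> ` X)" "bounded (\<phi> ` Y)"
    using X Y bdd bounded_subset image_mono by metis+
  obtain y where y: "y \<in> X" "y \<noteq> x" "diameter X \<le> 3 * dist x y"
    using exists_far_point[OF bX(1) X(2,3)] by blast
  have \<eta>0: "0 \<le> \<eta> (3 * c)"
    using homeomorphism_halfline_mono[OF \<eta>] le(2) by (metis mult_nonneg_nonneg order_refl zero_le_numeral)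
  have "dist (\<phi> x) (\<phi> z) \<le> \<eta> (3 * c) * diameter (\<phi> ` X)" if z: "z \<in> Y" for z
  proof -
    have "dist x z \<le> c * diameter X"
      using diameter_bounded_bound[OF bX(2) Y(2) z] le by linarith
    also have "\<dots> \<le> c * (3 * dist x y)"
      using y le by (intro mult_left_mono) auto
    finally have "dist x z / dist x y \<le> 3 * c"
      using y by (simp add: field_simps)
    then have "\<eta> (dist x z / dist x y) \<le> \<eta> (3 * c)"
      by (intro homeomorphism_halfline_mono(2)[OF \<eta>]) auto
    moreover have "dist (\<phi> x) (\<phi> z) / dist (\<phi> x) (\<phi> y) \<le> \<eta> (dist x z / dist x y)"
      using y X Y z by (intro qs) auto
    moreover have "0 < dist (\<phi> x) (\<phi> y)"
      using inj y X by (auto simp: inj_on_def)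
    ultimately have "dist (\<phi> x) (\<phi> z) \<le> \<eta> (3 * c) * dist (\<phi> x) (\<phi> y)"
      using order_trans pos_divide_le_eq by blast
    also have "\<dots> \<le> \<eta> (3 * c) * diameter (\<phi> ` X)"
      using \<eta>0 X(3) y bX by (intro mult_left_mono diameter_bounded_bound) auto
    finally show ?thesis .
  qed
  then show ?thesis
    using diameter_le_twice_radius[OF bX(4), of "\<eta> (3 * c) * diameter (\<phi> ` X)" "\<phi> x"]
      \<eta>0 diameter_ge_0[OF bX(3)] by (auto simp: mult.assoc)
qed

lemma (in quasi_visual) quasi_visual_image_if_quasisymmetry:
  fixes \<phi> :: "'a \<Rightarrow> 'b::metric_space"
  assumes "quasisymmetry S T \<phi>" and "bounded T"
  shows "\<exists>C' k0' r'. quasi_visual w T (\<lambda>n. (`) \<phi> ` \<X> n) C' k0' r'"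
proof -
  have inj: "inj_on \<phi> S" and T: "T = \<phi> ` S"
    using assms by (auto simp: quasisymmetry_def bij_betw_def)
  obtain \<eta> \<eta>' where \<eta>: "homeomorphism {0..} {0..} \<eta> \<eta>'"
    and qs: "\<And>x y z. x \<in> S \<Longrightarrow> y \<in> S \<Longrightarrow> z \<in> S \<Longrightarrow> x \<noteq> z \<Longrightarrow>
       dist (\<phi> x) (\<phi> y) / dist (\<phi> x) (\<phi> z) \<le> \<eta> (dist x y / dist x z)"
    using assms unfolding quasisymmetry_def by blast
  note \<eta>_mono = homeomorphism_halfline_mono(2)[OF \<eta>]
  note \<eta>_0 = homeomorphism_halfline_mono(1)[OF \<eta>]
  have bound: "diameter (\<phi> ` Y) \<le> 2 * \<eta> (3 * c) * diameter (\<phi> ` X)"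
    if "X \<in> \<X> n" "Y \<in> \<X> m" "x \<in> X" "x \<in> Y" "diameter Y \<le> c * diameter X" "0 \<le> c" for X Y n m c x
  proof (rule quasisymmetric_diameter_bound[OF \<eta> qs inj bounded_space])
    show "bounded (\<phi> ` S)" using assms(2) T by simp
  qed (use that tile_subset[OF that(1)] tile_subset[OF that(2)] diameter_pos[OF that(1,3)] in auto)
  have bimage: "bounded (\<phi> ` X)" if "X \<in> \<X> n" for X n
    by (rule bounded_subset[OF assms(2)]) (simp add: T image_mono tile_subset[OF that])
  have common: "\<exists>x. x \<in> X \<and> x \<in> Y"
    if meet: "\<phi> ` X \<inter> \<phi> ` Y \<noteq> {}" and tiles: "X \<in> \<X> n" "Y \<in> \<X> m" for X Y n m
  proof -
    obtain x y where "x \<in> X" "y \<in> Y" "\<phi> x = \<phi> y" using meet by blast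
    then show ?thesis
      using inj_onD[OF inj, of x y] tile_subset[OF tiles(1)] tile_subset[OF tiles(2)] by blast
  qed
  define C' where "C' = 1 + 2 * \<eta> (3 * C)"
  have C': "1 \<le> C'" "2 * \<eta> (3 * C) \<le> C'"
    using \<eta>_mono[of 0 "3 * C"] \<eta>_0 C_ge_1 by (auto simp: C'_def)
  have C'_bound: "diameter (\<phi> ` Y) \<le> C' * diameter (\<phi> ` X)"
    if "X \<in> \<X> n" "Y \<in> \<X> m" "x \<in> X" "x \<in> Y" "diameter Y \<le> C * diameter X" for X Y n m x
    using bound[OF that] C_ge_1 mult_right_mono[OF C'(2) diameter_ge_0[OF bimage[OF that(1)]]] by linarith
  \<comment> \<open>With \<open>1 / 4\<close>, the image diameters shrink by \<open>2 * \<eta> (3 * r ^ i) \<le> 1 / 2\<close> in \<open>k0 * i\<close> levels.\<close>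
  obtain i where i: "0 < i" "\<eta> (3 * r ^ i) \<le> 1 / 4"
  proof -
    have "continuous_on {0..} \<eta>" using \<eta> by (simp add: homeomorphism_def)
    moreover have "(\<lambda>i. 3 * r ^ i) \<longlonglongrightarrow> 3 * 0"
      using r_pos r_less_1 by (intro tendsto_intros LIMSEQ_power_zero) auto
    ultimately have "(\<lambda>i. \<eta> (3 * r ^ i)) \<longlonglongrightarrow> \<eta> (3 * 0)"
      using r_pos by (intro continuous_on_tendsto_compose[of "{0..}" \<eta>]) auto
    then have "\<forall>\<^sub>F i in sequentially. \<eta> (3 * r ^ i) < 1 / 4"
      using \<eta>_0 by (intro order_tendstoD) auto
    moreover have "\<forall>\<^sub>F i in sequentially. 0 < (i :: nat)"
      by (rule eventually_gt_at_top)
    ultimately have "\<forall>\<^sub>F i in sequentially. 0 < i \<and> \<eta> (3 * r ^ i) < 1 / 4"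
      by (rule eventually_conj[rotated])
    from eventually_happens'[OF _ this] show thesis
      using that by (auto intro: less_imp_le)
  qed
  have "quasi_visual w T (\<lambda>n. (`) \<phi> ` \<X> n) C' (k0 * i) (1 / 2)"
  proof
    show "bounded T" by fact
    show "\<exists>x\<in>T. \<exists>y\<in>T. x \<noteq> y"
      using two_points inj unfolding T inj_on_def by blast
    show "cover_of T ((`) \<phi> ` \<X> n)" for n
      unfolding T by (rule cover_of_image[OF cover])
    show "(`) \<phi> ` \<X> 0 = {T}" by (simp add: tiles_0 T)
    show "1 \<le> C'" by fact
    show "1 \<le> k0 * i" using i k0_ge_1 by simp
    show "0 < (1 / 2 :: real)" "1 / 2 < (1 :: real)" by auto
  next
    fix X' Y' n assume *: "X' \<in> (`) \<phi> ` \<X> n" "Y' \<in> (`) \<phi> ` \<X> n" "X' \<inter> Y' \<noteq> {}"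
    then obtain X Y where XY: "X' = \<phi> ` X" "Y' = \<phi> ` Y" "X \<in> \<X> n" "Y \<in> \<X> n" by blast
    then obtain x where "x \<in> X" "x \<in> Y" using common * by blast
    then show "diameter X' \<le> C' * diameter Y'"
      using C'_bound[of Y n X n x] same_level[of X n Y] XY by blast
  next
    fix X' Y' n assume *: "X' \<in> (`) \<phi> ` \<X> n" "Y' \<in> (`) \<phi> ` \<X> (Suc n)" "X' \<inter> Y' \<noteq> {}"
    then obtain X Y where XY: "X' = \<phi> ` X" "Y' = \<phi> ` Y" "X \<in> \<X> n" "Y \<in> \<X> (Suc n)" by blast
    then obtain x where "x \<in> X" "x \<in> Y" using common * by blast
    then show "diameter Y' \<le> C' * diameter X'" "diameter X' \<le> C' * diameter Y'"
      using C'_bound[of Y "Suc n" X n x] C'_bound[of X n Y "Suc n" x]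
        next_level_le[of X n Y] next_level_ge[of X n Y] XY by blast+
  next
    fix X' Y' n assume *: "X' \<in> (`) \<phi> ` \<X> n" "Y' \<in> (`) \<phi> ` \<X> (n + k0 * i)" "X' \<inter> Y' \<noteq> {}"
    then obtain X Y where XY: "X' = \<phi> ` X" "Y' = \<phi> ` Y" "X \<in> \<X> n" "Y \<in> \<X> (n + k0 * i)" by blast
    then obtain x where x: "x \<in> X" "x \<in> Y" using common * by blast
    have "diameter Y' \<le> 2 * \<eta> (3 * r ^ i) * diameter X'"
      using bound[OF XY(3,4) x iterated_shrink[OF XY(3) x(1) XY(4) x(2) i(1)]] r_pos XY by simp
    also have "\<dots> \<le> 1 / 2 * diameter X'"
      using i XY bimage by (intro mult_right_mono diameter_ge_0) auto
    finally show "diameter Y' \<le> 1 / 2 * diameter X'" .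
  next
    fix X' Y' n
    assume *: "X' \<in> (`) \<phi> ` \<X> n" "Y' \<in> (`) \<phi> ` \<X> n" "X' \<noteq> {}" "Y' \<noteq> {}"
      "tile_nbhd ((`) \<phi> ` \<X> n) w X' \<inter> tile_nbhd ((`) \<phi> ` \<X> n) w Y' = {}"
    then obtain X Y where XY: "X' = \<phi> ` X" "Y' = \<phi> ` Y" "X \<in> \<X> n" "Y \<in> \<X> n" by blast
    have ne: "X \<noteq> {}" "Y \<noteq> {}" using * XY by auto
    have sep: "diameter X \<le> C * setdist X Y"
      using * XY ne tile_nbhds_disjoint_image_iff[OF inj cover] separated by simp
    have "diameter X' / C' \<le> dist (\<phi> x) (\<phi> y)" if x: "x \<in> X" and y: "y \<in> Y" for x y
    proof -
      have xyS: "x \<in> S" "y \<in> S" using XY x y tile_subset by auto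
      have d: "diameter X \<le> C * dist x y"
        using sep mult_left_mono[OF setdist_le_dist[OF x y], of C] C_ge_1 by linarith
      then have "x \<noteq> y" using diameter_pos[OF XY(3) x] by auto
      have "dist (\<phi> x) (\<phi> z) \<le> \<eta> C * dist (\<phi> x) (\<phi> y)" if z: "z \<in> X" for z
      proof -
        have "dist x z \<le> C * dist x y"
          using dist_le_diameter[OF XY(3) x z] d by linarith
        then have "dist x z / dist x y \<le> C"
          using \<open>x \<noteq> y\<close> by (simp add: field_simps)
        then have "\<eta> (dist x z / dist x y) \<le> \<eta> C"
          by (intro \<eta>_mono) auto
        moreover have "dist (\<phi> x) (\<phi> z) / dist (\<phi> x) (\<phi> y) \<le> \<eta> (dist x z / dist x y)"
          using xyS \<open>x \<noteq> y\<close> z tile_subset[OF XY(3)] by (intro qs) auto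
        moreover have "0 < dist (\<phi> x) (\<phi> y)"
          using inj xyS \<open>x \<noteq> y\<close> by (auto simp: inj_on_def)
        ultimately show ?thesis
          using order_trans pos_divide_le_eq by blast
      qed
      then have "diameter X' \<le> 2 * (\<eta> C * dist (\<phi> x) (\<phi> y))"
        using \<eta>_mono[of 0 C] \<eta>_0 C_ge_1 bimage XY
        by (intro diameter_le_twice_radius[of _ _ "\<phi> x"]) auto
      also have "\<dots> \<le> C' * dist (\<phi> x) (\<phi> y)"
        using \<eta>_mono[of C "3 * C"] C_ge_1 C' mult_right_mono[of "2 * \<eta> C" C' "dist (\<phi> x) (\<phi> y)"]
        by simp
      finally show ?thesis using C' by (simp add: field_simps)
    qed
    then have "diameter X' / C' \<le> setdist X' Y'"
      using ne XY by (intro le_setdistI) auto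
    then show "diameter X' \<le> C' * setdist X' Y'"
      using C' by (simp add: field_simps)
  qed
  then show ?thesis by blast
qed

section \<open>Quasi-visual approximations in correspondence force quasisymmetry\<close>

lemma exists_power_mult_le_1:
  fixes c q :: real
  assumes "0 < q" "q < 1" "0 < c"
  shows "\<exists>N. \<forall>n\<ge>N. c * q ^ n \<le> 1"
proof -
  have "(\<lambda>n. c * q ^ n) \<longlonglongrightarrow> c * 0"
    using assms by (intro tendsto_intros LIMSEQ_power_zero) auto
  then have "\<forall>\<^sub>F n in sequentially. c * q ^ n < 1"
    by (intro order_tendstoD) auto
  then show ?thesis
    unfolding eventually_sequentially using less_imp_le by blast
qed

text \<open>
  The ratios of distances on both sides are translated into ratios of tile diameters at the
  levels \<open>n\<close> of \<open>(x, y)\<close> and \<open>m\<close> of \<open>(x, z)\<close>, and these are compared through \<open>m - n\<close>.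
\<close>
lemma quasisymmetry_if_quasi_visual_image:
  fixes \<phi> :: "'a::metric_space \<Rightarrow> 'b::metric_space"
  assumes bij: "bij_betw \<phi> S T"
    and qS: "quasi_visual w S \<X> C k0 r"
    and qT: "quasi_visual w T (\<lambda>n. (`) \<phi> ` \<X> n) C' k0' r'"
  shows "quasisymmetry S T \<phi>"
proof -
  interpret S: quasi_visual w S \<X> C k0 r by (rule qS)
  interpret T: quasi_visual w T "\<lambda>n. (`) \<phi> ` \<X> n" C' k0' r' by (rule qT)
  have inj: "inj_on \<phi> S" and T: "T = \<phi> ` S"
    using bij by (auto simp: bij_betw_def)
  obtain K where K: "1 \<le> K"
    "\<And>n x y X. linked \<X> w n x y \<Longrightarrow> X \<in> \<X> n \<Longrightarrow> x \<in> X \<Longrightarrow> dist x y \<le> K * diameter X"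
    using S.dist_le_if_linked by metis
  obtain K' where K': "1 \<le> K'"
    "\<And>n x y X. linked (\<lambda>n. (`) \<phi> ` \<X> n) w n x y \<Longrightarrow> X \<in> (`) \<phi> ` \<X> n \<Longrightarrow> x \<in> X \<Longrightarrow> dist x y \<le> K' * diameter X"
    using T.dist_le_if_linked by metis
  obtain A q where A: "1 \<le> A" "0 < q" "q < 1"
    "\<And>X n x Y j. X \<in> \<X> n \<Longrightarrow> x \<in> X \<Longrightarrow> Y \<in> \<X> (n + j) \<Longrightarrow> x \<in> Y \<Longrightarrow> diameter Y \<le> A * q ^ j * diameter X"
    using S.geometric_decay by metis
  obtain A' q' where A': "1 \<le> A'" "0 < q'" "q' < 1"
    "\<And>X n x Y j. X \<in> (`) \<phi> ` \<X> n \<Longrightarrow> x \<in> X \<Longrightarrow> Y \<in> (`) \<phi> ` \<X> (n + j) \<Longrightarrow> x \<in> Y \<Longrightarrow>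
      diameter Y \<le> A' * q' ^ j * diameter X"
    using T.geometric_decay by metis
  \<comment> \<open>The exponent \<open>N\<close> is chosen such that the slowest decay on one side, raised to the power
    \<open>N\<close>, still beats the fastest decay on the other side.\<close>
  obtain N1 where N1: "\<forall>n\<ge>N1. C * q' ^ n \<le> 1"
    using exists_power_mult_le_1[of q' C] A' S.C_ge_1 by auto
  obtain N2 where N2: "\<forall>n\<ge>N2. C' * q ^ n \<le> 1"
    using exists_power_mult_le_1[of q C'] A T.C_ge_1 by auto
  define N where "N = Suc (max N1 N2)"
  have N: "0 < N" "C * q' ^ N \<le> 1" "C' * q ^ N \<le> 1"
    using N1[rule_format, of N] N2[rule_format, of N] by (simp_all add: N_def)
  \<comment> \<open>\<open>F\<close> collects all constants lost in \<open>S\<close> and \<open>E\<close> those lost in \<open>T\<close>, so that one pair of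
    constants serves both cases of the estimate below.\<close>
  define F where "F = K * C ^ 2 * C * A"
  define E where "E = K' * C' ^ 2 * C' * A'"
  have F1: "1 \<le> F" "1 \<le> K * C ^ 2" "1 \<le> C ^ 2"
  proof -
    show c: "1 \<le> C ^ 2" using S.C_ge_1 by simp
    then show kc: "1 \<le> K * C ^ 2" using mult_mono[OF K(1) c] K by simp
    show "1 \<le> F" using mult_mono[OF mult_mono[OF kc S.C_ge_1] A(1)] kc S.C_ge_1 by (simp add: F_def)
  qed
  have E1: "1 \<le> E" "1 \<le> K' * C' ^ 2" "1 \<le> C' ^ 2"
  proof -
    show c: "1 \<le> C' ^ 2" using T.C_ge_1 by simp
    then show kc: "1 \<le> K' * C' ^ 2" using mult_mono[OF K'(1) c] K' by simp
    show "1 \<le> E" using mult_mono[OF mult_mono[OF kc T.C_ge_1] A'(1)] kc T.C_ge_1 by (simp add: E_def)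
  qed
  define L where "L = E * F ^ N"
  have L: "0 < L" using E1 F1 by (simp add: L_def)
  define \<eta> where "\<eta> t = L * max (root N t) (t ^ N)" for t
  have \<eta>_homeo: "homeomorphism {0..} {0..} \<eta> (\<lambda>s. min ((s / L) ^ N) (root N (s / L)))"
    unfolding \<eta>_def[abs_def] using N L by (intro homeomorphism_max_root_power)
  have "dist (\<phi> x) (\<phi> y) / dist (\<phi> x) (\<phi> z) \<le> \<eta> (dist x y / dist x z)"
    if S: "x \<in> S" "y \<in> S" "z \<in> S" and xz: "x \<noteq> z" for x y z
  proof (cases "x = y")
    case True
    then show ?thesis using N(1) L by (simp add: \<eta>_def)
  next
    case xy: False
    \<comment> \<open>One level computes the distances of a pair of points and of its image simultaneously.\<close>
    have comparison: "\<exists>n. \<forall>X\<in>\<X> n. x \<in> X \<longrightarrow>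
        dist x v \<le> K * diameter X \<and> diameter X \<le> C\<^sup>2 * dist x v \<and>
        dist (\<phi> x) (\<phi> v) \<le> K' * diameter (\<phi> ` X) \<and> diameter (\<phi> ` X) \<le> C'\<^sup>2 * dist (\<phi> x) (\<phi> v)"
      if v: "v \<in> S" "x \<noteq> v" for v
    proof -
      obtain n where n: "linked \<X> w n x v" "\<not> linked \<X> w (Suc n) x v"
        using S.separation_level S v by metis
      have n': "linked (\<lambda>n. (`) \<phi> ` \<X> n) w n (\<phi> x) (\<phi> v)"
          "\<not> linked (\<lambda>n. (`) \<phi> ` \<X> n) w (Suc n) (\<phi> x) (\<phi> v)"
        using n linked_image_iff[OF inj S.cover S(1) v(1)] by auto
      have "dist x v \<le> K * diameter X \<and> diameter X \<le> C\<^sup>2 * dist x v \<and>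
        dist (\<phi> x) (\<phi> v) \<le> K' * diameter (\<phi> ` X) \<and> diameter (\<phi> ` X) \<le> C'\<^sup>2 * dist (\<phi> x) (\<phi> v)"
        if X: "X \<in> \<X> n" "x \<in> X" for X
        using K(2)[OF n(1) X] S.diameter_le_if_not_linked[OF n(2) X v(1)]
          K'(2)[OF n'(1), of "\<phi> ` X"] T.diameter_le_if_not_linked[OF n'(2), of "\<phi> ` X"] X v(1)
        by (simp add: T power2_eq_square)
      then show ?thesis by blast
    qed
    obtain n where n: "\<forall>X\<in>\<X> n. x \<in> X \<longrightarrow>
        dist x y \<le> K * diameter X \<and> diameter X \<le> C\<^sup>2 * dist x y \<and>
        dist (\<phi> x) (\<phi> y) \<le> K' * diameter (\<phi> ` X) \<and> diameter (\<phi> ` X) \<le> C'\<^sup>2 * dist (\<phi> x) (\<phi> y)"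
      using comparison[OF S(2) xy] by blast
    obtain m where m: "\<forall>X\<in>\<X> m. x \<in> X \<longrightarrow>
        dist x z \<le> K * diameter X \<and> diameter X \<le> C\<^sup>2 * dist x z \<and>
        dist (\<phi> x) (\<phi> z) \<le> K' * diameter (\<phi> ` X) \<and> diameter (\<phi> ` X) \<le> C'\<^sup>2 * dist (\<phi> x) (\<phi> z)"
      using comparison[OF S(3) xz] by blast
    obtain X where X: "X \<in> \<X> n" "x \<in> X" using S.exists_tile S by blast
    obtain Z where Z: "Z \<in> \<X> m" "x \<in> Z" using S.exists_tile S by blast
    define s where "s = dist (\<phi> x) (\<phi> y) / dist (\<phi> x) (\<phi> z)"
    define t where "t = dist x y / dist x z"
    define D where "D = diameter X / diameter Z"
    define D' where "D' = diameter (\<phi> ` X) / diameter (\<phi> ` Z)"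
    have pos: "0 < diameter X" "0 < diameter Z" "0 < diameter (\<phi> ` X)" "0 < diameter (\<phi> ` Z)"
      using S.diameter_pos[OF X] S.diameter_pos[OF Z] X Z
        T.diameter_pos[of "\<phi> ` X" n "\<phi> x"] T.diameter_pos[of "\<phi> ` Z" m "\<phi> x"] by simp_all
    have "0 < dist x z" "0 < dist (\<phi> x) (\<phi> z)"
      using xz S inj by (auto simp: inj_on_def)
    have t_ge: "D \<le> K * C\<^sup>2 * t"
    proof -
      have "diameter X * dist x z \<le> (C\<^sup>2 * dist x y) * (K * diameter Z)"
        using n m X Z pos by (intro mult_mono) auto
      then show ?thesis
        using pos \<open>0 < dist x z\<close> unfolding D_def t_def by (simp add: field_simps)
    qed
    have s_le: "s \<le> K' * C'\<^sup>2 * D'"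
    proof -
      have "dist (\<phi> x) (\<phi> y) * diameter (\<phi> ` Z) \<le> (K' * diameter (\<phi> ` X)) * (C'\<^sup>2 * dist (\<phi> x) (\<phi> z))"
        using n m X Z pos K' by (intro mult_mono) auto
      then show ?thesis
        using pos \<open>0 < dist (\<phi> x) (\<phi> z)\<close> unfolding D'_def s_def by (simp add: field_simps)
    qed
    have t0: "0 \<le> t" and s0: "0 \<le> s" by (auto simp: t_def s_def)
    \<comment> \<open>If \<open>n = m + j\<close>, the ratio \<open>s\<close> is small like \<open>q' ^ j\<close> while \<open>t\<close> is not smaller than a
      multiple of \<open>C ^ (- j)\<close>, which gives the root.  If \<open>m = n + j\<close>, then \<open>s\<close> is at most of order
      \<open>C' ^ j\<close> while \<open>t\<close> is at least of order \<open>q ^ (- j)\<close>, which gives the power.\<close>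
    have "s \<le> L * max (root N t) (t ^ N)"
    proof (cases "m \<le> n")
      case True
      then obtain j where j: "n = m + j" using le_iff_add by blast
      have "D' \<le> A' * q' ^ j"
        using A'(4)[of "\<phi> ` Z" m "\<phi> x" "\<phi> ` X" j] X Z pos by (simp add: j D'_def field_simps)
      then have "s \<le> K' * C'\<^sup>2 * (A' * q' ^ j)"
        using s_le E1 mult_left_mono[of D' "A' * q' ^ j" "K' * C'\<^sup>2"] by linarith
      also have "\<dots> \<le> E * q' ^ j"
      proof -
        have "K' * C'\<^sup>2 * 1 * A' \<le> E"
          unfolding E_def using T.C_ge_1 E1 A' by (intro mult_right_mono mult_left_mono) auto
        then show ?thesis
          using A' mult_right_mono[of "K' * C'\<^sup>2 * 1 * A'" E "q' ^ j"] by (simp add: mult_ac)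
      qed
      also have "q' ^ j \<le> root N (F * t)"
      proof -
        have "1 \<le> C ^ Suc j * D"
          using S.deeper_level_bounds(1)[OF Z, of X j] X pos by (simp add: j D_def field_simps)
        also have "\<dots> \<le> C ^ Suc j * (K * C\<^sup>2 * t)"
          using t_ge S.C_ge_1 by (intro mult_left_mono) auto
        also have "\<dots> = C ^ j * (K * C\<^sup>2 * C * 1 * t)" by simp
        also have "\<dots> \<le> C ^ j * (F * t)"
          unfolding F_def using S.C_ge_1 F1 A t0 by (intro mult_left_mono mult_right_mono) auto
        finally have one: "1 \<le> C ^ j * (F * t)" .
        have "(q' ^ j) ^ N = (q' ^ N) ^ j * 1"
          by (simp flip: power_mult add: mult.commute)
        also have "\<dots> \<le> (q' ^ N) ^ j * (C ^ j * (F * t))"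
          using one A' by (intro mult_left_mono) auto
        also have "\<dots> = (C * q' ^ N) ^ j * (F * t)"
          by (simp add: power_mult_distrib mult_ac)
        also have "\<dots> \<le> 1 * (F * t)"
          using N A' S.C_ge_1 F1 t0 by (intro mult_right_mono power_le_one) auto
        finally have "root N ((q' ^ j) ^ N) \<le> root N (F * t)"
          using N by simp
        then show ?thesis
          using N A' by (simp add: real_root_power_cancel)
      qed
      also have "root N (F * t) \<le> F ^ N * root N t"
      proof -
        have "F \<le> F ^ N" using F1 N power_increasing[of 1 N F] by simp
        also have "\<dots> \<le> (F ^ N) ^ N"
          using F1 N power_increasing[of 1 N "F ^ N"] by simp
        finally have "root N F \<le> F ^ N"
          using N F1 by (metis real_root_le_iff real_root_power_cancel zero_le_one order_trans zero_le_power)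
        then show ?thesis
          using t0 N by (simp add: real_root_mult mult_right_mono)
      qed
      finally have "s \<le> E * (F ^ N * root N t)" using E1 by simp
      also have "\<dots> \<le> L * max (root N t) (t ^ N)"
        unfolding L_def using E1 F1 by simp
      finally show ?thesis .
    next
      case False
      then obtain j where j: "m = n + j" by (metis le_iff_add nat_le_linear)
      have "D' \<le> C' ^ Suc j"
        using T.deeper_level_bounds(1)[of "\<phi> ` X" n "\<phi> x" "\<phi> ` Z" j] X Z pos
        by (simp add: j D'_def field_simps)
      then have "s \<le> K' * C'\<^sup>2 * C' ^ Suc j"
        using s_le E1 mult_left_mono[of D' "C' ^ Suc j" "K' * C'\<^sup>2"] by linarith
      also have "\<dots> \<le> E * C' ^ j"
      proof -
        have "K' * C'\<^sup>2 * C' * 1 \<le> E"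
          unfolding E_def using T.C_ge_1 E1 A' by (intro mult_left_mono) auto
        then show ?thesis
          using T.C_ge_1 mult_right_mono[of "K' * C'\<^sup>2 * C' * 1" E "C' ^ j"] by (simp add: mult_ac)
      qed
      also have "C' ^ j \<le> (F * t) ^ N"
      proof -
        have "1 \<le> A * q ^ j * D"
          using A(4)[OF X, of Z j] Z pos by (simp add: j D_def field_simps)
        also have "\<dots> \<le> A * q ^ j * (K * C\<^sup>2 * t)"
          using t_ge A by (intro mult_left_mono) auto
        also have "\<dots> = q ^ j * (K * C\<^sup>2 * 1 * A * t)" by simp
        also have "\<dots> \<le> q ^ j * (F * t)"
          unfolding F_def using S.C_ge_1 F1 A t0 by (intro mult_left_mono mult_right_mono) auto
        finally have "1 \<le> (q ^ j * (F * t)) ^ N" by simp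
        then have "C' ^ j * 1 \<le> C' ^ j * (q ^ j * (F * t)) ^ N"
          using T.C_ge_1 by (intro mult_left_mono) auto
        also have "\<dots> = (C' * q ^ N) ^ j * (F * t) ^ N"
          by (simp add: power_mult_distrib mult_ac flip: power_mult)
        also have "\<dots> \<le> 1 * (F * t) ^ N"
          using N A T.C_ge_1 F1 t0 by (intro mult_right_mono power_le_one) auto
        finally show ?thesis by simp
      qed
      finally have "s \<le> E * (F * t) ^ N" using E1 by simp
      also have "\<dots> \<le> L * max (root N t) (t ^ N)"
        unfolding L_def using E1 F1 by (simp add: power_mult_distrib)
      finally show ?thesis .
    qed
    then show ?thesis by (simp add: \<eta>_def s_def t_def)
  qed
  then show ?thesis
    unfolding quasisymmetry_def using bij \<eta>_homeo by blast
qed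

theorem corollary7p4:
  fixes S :: "'a::metric_space set" and T :: "'b::metric_space set"
    and \<phi> :: "'a \<Rightarrow> 'b"
    and \<X> :: "nat \<Rightarrow> 'a set set" and \<Y> :: "nat \<Rightarrow> 'b set set"
  assumes "bounded S" and "bounded T"
    and "bij_betw \<phi> S T"
    and "quasi_visual_approx S \<X>"
    and "\<And>n. \<Y> n = {\<phi> ` X | X. X \<in> \<X> n}"
  shows "quasisymmetry S T \<phi> \<longleftrightarrow> quasi_visual_approx T \<Y>"
proof -
  have Y: "\<Y> = (\<lambda>n. (`) \<phi> ` \<X> n)"
    using assms(5) by (intro ext) (simp only: Setcompr_eq_image)
  obtain w C k0 r where qS: "quasi_visual w S \<X> C k0 r"
    using assms(4) unfolding quasi_visual_approx_def quasi_visual_approx_width_iff by blast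
  show ?thesis
  proof
    assume "quasisymmetry S T \<phi>"
    then show "quasi_visual_approx T \<Y>"
      using quasi_visual.quasi_visual_image_if_quasisymmetry[OF qS _ assms(2)]
      unfolding quasi_visual_approx_def quasi_visual_approx_width_iff Y by blast
  next
    assume "quasi_visual_approx T \<Y>"
    then obtain w' C' k0' r' where qT: "quasi_visual w' T (\<lambda>n. (`) \<phi> ` \<X> n) C' k0' r'"
      unfolding quasi_visual_approx_def quasi_visual_approx_width_iff Y by blast
    show "quasisymmetry S T \<phi>"
      using quasisymmetry_if_quasi_visual_image[OF assms(3)
          quasi_visual.quasi_visual_wider[OF qS, of "max w w'"]
          quasi_visual.quasi_visual_wider[OF qT, of "max w w'"]] by simp
  qed
qed

end
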